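(* Let $m_1,m_2,\ldots$ be nonnegative integers, let $n\ge 1$, and consider one of the three types of combinatorial structure (assemblies, multisets, selections) determined by $(m_i)$. Let $x>0$, with $x<1$ in the case of multisets, let $\mathbf{D}(n)=(D_{ij}(n),\,1\le i\le n,\,1\le j\le m_i)$ be the refined component counting process of a uniformly chosen structure of weight $n$, and let $\mathbf{Y}(n)=(Y_{ij},\,1\le i\le n,\,1\le j\le m_i)$ be the corresponding refined independent process with parameter $x$, with $T_n=\sum_{i=1}^n\sum_{j=1}^{m_i}iY_{ij}$. If $\mathbb{P}(T_n=n)>0$, then $$\mathbf{D}(n)\stackrel{d}{=}(\mathbf{Y}(n)\mid T_n=n).$$
   Context: Let $m_1,m_2,\ldots$ be nonnegative integers. An assembly on $[n]=\{1,\ldots,n\}$ (weight $n$) is a partition of the set $[n]$ into nonempty blocks together with, for each block of size $i$, a choice of one of $m_i$ possible structures on that block, labelled $1,\ldots,m_i$. For multisets and selections, there are $m_i$ distinct objects of weight $i$, labelled $1,\ldots,m_i$, for each $i\ge 1$; a multiset of weight $n$ is an unordered collection of such objects, repetitions allowed, of total weight $n$; a selection of weight $n$ is an unordered collection of distinct such objects of total weight $n$. In each case the blocks (or the objects in the collection) are the components, and $D_{ij}(n)$ is the number of components of size (weight) $i$ having the $j$-th structure (being the $j$-th object of weight $i$), when a structure of weight $n$ is chosen uniformly at random among all structures of weight $n$ of the given type. The random variables $Y_{ij}$ are mutually independent with, for $1\le j\le m_i$: for assemblies, $Y_{ij}$ Poisson with mean $x^i/i!$; for multisets ($0<x<1$),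 $\mathbb{P}(Y_{ij}=k)=(1-x^i)x^{ik}$, $k=0,1,\ldots$; for selections, $\mathbb{P}(Y_{ij}=0)=1/(1+x^i)$ and $\mathbb{P}(Y_{ij}=1)=x^i/(1+x^i)$. $\stackrel{d}{=}$ denotes equality in distribution, and $(\mathbf{Y}(n)\mid T_n=n)$ the conditional distribution given $\{T_n=n\}$. *)

theory Defs
  imports "HOL-Probability.Probability"
begin

datatype comb_type = Assemblies | Multisets | Selections

text \<open>In \<open>Assembly P f\<close>, \<open>P\<close> is the set of blocks and \<open>f B\<close> is the label of the structure on the
  block \<open>B\<close>. In the other two cases the pair \<open>(i, j)\<close> stands for the \<open>j\<close>-th object of weight \<open>i\<close>.\<close>

datatype comb_structure =
    Assembly "nat set set" "nat set \<Rightarrow> nat"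
  | Multiset "(nat \<times> nat) multiset"
  | Selection "(nat \<times> nat) set"

definition objects :: "(nat \<Rightarrow> nat) \<Rightarrow> (nat \<times> nat) set" where
  "objects m = (SIGMA i:{1..}. {1..m i})"

definition refined_index :: "(nat \<Rightarrow> nat) \<Rightarrow> nat \<Rightarrow> (nat \<times> nat) set" where
  "refined_index m n = (SIGMA i:{1..n}. {1..m i})"

text \<open>The extensional function space makes equality of assemblies depend only on the labels of
  actual blocks.\<close>

fun structures :: "comb_type \<Rightarrow> (nat \<Rightarrow> nat) \<Rightarrow> nat \<Rightarrow> comb_structure set" where
  "structures Assemblies m n =
     {Assembly P f | P f. partition_on {1..n} P \<and> f \<in> (\<Pi>\<^sub>E B\<in>P. {1..m (card B)})}"
| "structures Multisets m n =
     {Multiset C | C. set_mset C \<subseteq> objects m \<and> (\<Sum>c\<in>#C. fst c) = n}"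
| "structures Selections m n =
     {Selection S | S. finite S \<and> S \<subseteq> objects m \<and> (\<Sum>c\<in>S. fst c) = n}"

fun component_count :: "nat \<times> nat \<Rightarrow> comb_structure \<Rightarrow> nat" where
  "component_count (i, j) (Assembly P f) = card {B \<in> P. card B = i \<and> f B = j}"
| "component_count (i, j) (Multiset C) = count C (i, j)"
| "component_count (i, j) (Selection S) = (if (i, j) \<in> S then 1 else 0)"

fun component_pmf :: "comb_type \<Rightarrow> real \<Rightarrow> nat \<Rightarrow> nat pmf" where
  "component_pmf Assemblies x i = poisson_pmf (x ^ i / fact i)"
| "component_pmf Multisets x i = geometric_pmf (1 - x ^ i)"
| "component_pmf Selections x i = map_pmf of_bool (bernoulli_pmf (x ^ i / (1 + x ^ i)))"

text \<open>The library's geometric distribution is supported on \<open>0, 1, \<dots>\<close> and its parameter is the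
  success probability; the next lemmas give the resulting mass functions.\<close>

lemma pmf_component_Assemblies:
  assumes "0 < x"
  shows "pmf (component_pmf Assemblies x i) k
    = (x ^ i / fact i) ^ k / fact k * exp (- (x ^ i / fact i))"
  using assms by simp

lemma pmf_component_Multisets:
  assumes "0 < x" "x < 1" "1 \<le> i"
  shows "pmf (component_pmf Multisets x i) k = (1 - x ^ i) * x ^ (i * k)"
proof -
  have "x ^ i < 1" "0 < x ^ i"
    using assms by (auto simp: power_less_one_iff)
  then show ?thesis by (simp add: power_mult)
qed

lemma pmf_component_Selections:
  assumes "0 < x"
  shows "pmf (component_pmf Selections x i) 0 = 1 / (1 + x ^ i)"
    and "pmf (component_pmf Selections x i) 1 = x ^ i / (1 + x ^ i)"
proof -
  define p where "p = x ^ i / (1 + x ^ i)"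
  have pos: "0 < x ^ i" using assms by simp
  then have p: "0 \<le> p" "p \<le> 1" "1 - p = 1 / (1 + x ^ i)"
    by (auto simp: p_def field_simps)
  have inj: "inj (of_bool :: bool \<Rightarrow> nat)" by (auto simp: inj_on_def)
  have "pmf (map_pmf of_bool (bernoulli_pmf p)) (of_bool b :: nat) = pmf (bernoulli_pmf p) b" for b
    by (rule pmf_map_inj') (rule inj)
  from this[of False] this[of True]
  show "pmf (component_pmf Selections x i) 0 = 1 / (1 + x ^ i)"
    and "pmf (component_pmf Selections x i) 1 = x ^ i / (1 + x ^ i)"
    using p by (simp_all add: p_def)
qed

end

theory Submission
  imports Defs
begin

text \<open>For a vector \<open>a\<close> of component counts with \<open>\<Sum> i a\<^sub>i\<^sub>j = n\<close>, the number of structures of weight \<open>n\<close>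
  with counts \<open>a\<close> is \<open>n! / \<Prod> (i!)\<^bsup>a\<^sub>i\<^sub>j\<^esup> a\<^sub>i\<^sub>j!\<close> for assemblies, \<open>1\<close> for multisets, and \<open>1\<close> or \<open>0\<close> for
  selections according to whether all \<open>a\<^sub>i\<^sub>j \<le> 1\<close>. In \<open>P(Y = a)\<close> the parameter \<open>x\<close> enters through
  \<open>x\<^bsup>\<Sum> i a\<^sub>i\<^sub>j\<^esup> = x\<^sup>n\<close> and a normalising product that does not depend on \<open>a\<close>. Hence both laws are
  proportional to the same function on the finite set of admissible \<open>a\<close>, so they agree.\<close>

section \<open>Counting assemblies with prescribed component counts\<close>

text \<open>The ground set \<open>A\<close> is arbitrary so that deleting a block leaves an object
  of the same kind. Prescribing the count at every \<open>q\<close> rules out blocks of any type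
  where \<open>a\<close> vanishes.\<close>

definition assembly_fibre ::
    "(nat \<Rightarrow> nat) \<Rightarrow> nat set \<Rightarrow> (nat \<times> nat \<Rightarrow> nat) \<Rightarrow> (nat set set \<times> (nat set \<Rightarrow> nat)) set" where
  "assembly_fibre m A a = {(P, f). partition_on A P \<and> f \<in> (\<Pi>\<^sub>E B\<in>P. {1..m (card B)}) \<and>
     (\<forall>q. card {B \<in> P. (card B, f B) = q} = a q)}"

lemma component_count_Assembly:
  "component_count q (Assembly P f) = card {B \<in> P. (card B, f B) = q}"
  by (cases q) simp

lemma finite_assemblies:
  fixes m :: "nat \<Rightarrow> nat"
  assumes "finite A"
  shows "finite {(P, f). partition_on A P \<and> f \<in> (\<Pi>\<^sub>E B\<in>P. {1..m (card B)})}"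
proof -
  have "{(P, f). partition_on A P \<and> f \<in> (\<Pi>\<^sub>E B\<in>P. {1..m (card B)})}
      = (SIGMA P:{P. partition_on A P}. \<Pi>\<^sub>E B\<in>P. {1..m (card B)})"
    by auto
  moreover have "finite (\<Pi>\<^sub>E B\<in>P. {1..m (card B)})" if "partition_on A P" for P
    using finite_elements[OF assms that] by (intro finite_PiE) auto
  ultimately show ?thesis
    using assms by (auto intro!: finite_SigmaI finitely_many_partition_on)
qed

lemma finite_assembly_fibre: "finite A \<Longrightarrow> finite (assembly_fibre m A a)"
  by (rule finite_subset[OF _ finite_assemblies[of A m]]) (auto simp: assembly_fibre_def)

text \<open>One half of the bijection behind \<open>card_assembly_fibre_step\<close>: the other
  blocks are disjoint from \<open>B\<close>, hence cover \<open>A - B\<close>, and only the count at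
  the type of \<open>B\<close> drops. Restricting \<open>f\<close> keeps the labelling
  extensional.\<close>

lemma remove_block_in_fibre:
  assumes F: "(P, f) \<in> assembly_fibre m A a" and B: "B \<in> P" "(card B, f B) = p"
  shows "(P - {B}, restrict f (P - {B})) \<in> assembly_fibre m (A - B) (a(p := a p - 1))"
proof -
  have P: "partition_on A P" and f: "f \<in> (\<Pi>\<^sub>E B\<in>P. {1..m (card B)})"
    and c: "\<And>q. card {B \<in> P. (card B, f B) = q} = a q"
    using F by (auto simp: assembly_fibre_def)
  have "C \<inter> B = {}" if "C \<in> P - {B}" for C
    using partition_onD2[OF P] B(1) that by (auto simp: disjoint_def)
  then have "\<Union> (P - {B}) = A - B"
    using partition_onD1[OF P] by blast
  then have "partition_on (A - B) (P - {B})"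
    using P unfolding partition_on_def by (auto simp: disjoint_def)
  moreover have "card {C \<in> P - {B}. (card C, restrict f (P - {B}) C) = q} = (a(p := a p - 1)) q" for q
  proof -
    define S where "S = {C \<in> P. (card C, f C) = q}"
    have "{C \<in> P - {B}. (card C, restrict f (P - {B}) C) = q} = S - {B}"
      by (auto simp: S_def)
    moreover have "B \<in> S \<longleftrightarrow> q = p" using B by (auto simp: S_def)
    moreover have "card S = a q" using c[of q] by (simp only: S_def)
    ultimately show ?thesis by (simp add: card_Diff_singleton_if)
  qed
  moreover have "restrict f (P - {B}) \<in> (\<Pi>\<^sub>E C\<in>P - {B}. {1..m (card C)})"
    using f by auto
  ultimately show ?thesis unfolding assembly_fibre_def by blast
qed

text \<open>The inverse move. A nonempty \<open>B\<close> cannot be a block of a partition of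
  \<open>A - B\<close>, so it really is new and raises the count at \<open>p\<close> by one;
  \<open>a p > 0\<close> guards against truncated subtraction in \<open>a p - 1\<close>.\<close>

lemma insert_block_in_fibre:
  assumes A: "finite A" and F: "(P, f) \<in> assembly_fibre m (A - B) (a(p := a p - 1))"
    and B: "B \<subseteq> A" "B \<noteq> {}" and p: "p = (card B, j)" "j \<in> {1..m (card B)}" "a p > 0"
  shows "(insert B P, f(B := j)) \<in> assembly_fibre m A a" and "B \<notin> P"
proof -
  have P: "partition_on (A - B) P" and f: "f \<in> (\<Pi>\<^sub>E B\<in>P. {1..m (card B)})"
    and c: "\<And>q. card {B \<in> P. (card B, f B) = q} = (a(p := a p - 1)) q"
    using F by (auto simp: assembly_fibre_def)
  have fin: "finite P" using P A by (intro finite_elements[of "A - B"]) auto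
  show nB: "B \<notin> P" using P B unfolding partition_on_def by blast
  have "partition_on A (insert B P)"
    using P B by (auto simp: partition_on_def disjoint_def)
  moreover have "f(B := j) \<in> (\<Pi>\<^sub>E C\<in>insert B P. {1..m (card C)})"
    using f p nB by (auto simp: PiE_iff extensional_def)
  moreover have "card {C \<in> insert B P. (card C, (f(B := j)) C) = q} = a q" for q
  proof -
    have "{C \<in> insert B P. (card C, (f(B := j)) C) = q}
        = (if q = p then insert B else id) {C \<in> P. (card C, f C) = q}"
      using nB p by auto
    then show ?thesis using c[of q] fin nB p by (auto split: if_splits)
  qed
  ultimately show "(insert B P, f(B := j)) \<in> assembly_fibre m A a"
    unfolding assembly_fibre_def by blast
qed

text \<open>Counts the pairs of an assembly with component counts \<open>a\<close> and one of its blocks of type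
  \<open>(i, j)\<close> in two ways.\<close>

lemma card_assembly_fibre_step:
  assumes A: "finite A" and ij: "1 \<le> i" "j \<in> {1..m i}" and pos: "a (i, j) > 0"
  shows "a (i, j) * card (assembly_fibre m A a)
    = (\<Sum>B | B \<subseteq> A \<and> card B = i. card (assembly_fibre m (A - B) (a((i, j) := a (i, j) - 1))))"
proof -
  define p where "p = (i, j)"
  define b where "b = a(p := a p - 1)"
  \<comment> \<open>\<open>X\<close> marks a block of type \<open>p\<close> in an assembly on
    \<open>A\<close>; \<open>Z\<close> first chooses that block and then an assembly on the
    remaining points.\<close>
  define X where "X = (SIGMA s:assembly_fibre m A a. {B \<in> fst s. (card B, snd s B) = p})"
  define Z where "Z = (SIGMA B:{B. B \<subseteq> A \<and> card B = i}. assembly_fibre m (A - B) b)"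
  have fin: "finite P" if "(P, f) \<in> assembly_fibre m A a" for P f
    using that A by (auto simp: assembly_fibre_def intro: finite_elements)
  have "card X = (\<Sum>s\<in>assembly_fibre m A a. card {B \<in> fst s. (card B, snd s B) = p})"
    unfolding X_def using fin
    by (intro card_SigmaI finite_assembly_fibre A) auto
  also have "\<dots> = a p * card (assembly_fibre m A a)"
  proof -
    have "card {B \<in> fst s. (card B, snd s B) = p} = a p" if "s \<in> assembly_fibre m A a" for s
      using that by (cases s) (simp add: assembly_fibre_def p_def)
    then show ?thesis by simp
  qed
  finally have X: "card X = a p * card (assembly_fibre m A a)" .
  have Z: "card Z = (\<Sum>B | B \<subseteq> A \<and> card B = i. card (assembly_fibre m (A - B) b))"
    unfolding Z_def using A by (intro card_SigmaI) (auto intro: finite_assembly_fibre)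
  define g :: "(nat set set \<times> (nat set \<Rightarrow> nat)) \<times> nat set \<Rightarrow> nat set \<times> nat set set \<times> (nat set \<Rightarrow> nat)"
    where "g = (\<lambda>((P, f), B). (B, P - {B}, restrict f (P - {B})))"
  define h :: "nat set \<times> nat set set \<times> (nat set \<Rightarrow> nat) \<Rightarrow> (nat set set \<times> (nat set \<Rightarrow> nat)) \<times> nat set"
    where "h = (\<lambda>(B, P, f). ((insert B P, f(B := j)), B))"
  have "h (g ((P, f), B)) = ((P, f), B)" "g ((P, f), B) \<in> Z" if "((P, f), B) \<in> X" for P f B
  proof -
    have F: "(P, f) \<in> assembly_fibre m A a" and B: "B \<in> P" "(card B, f B) = p"
      using that by (auto simp: X_def)
    \<comment> \<open>The restriction forgets only the value at \<open>B\<close>, which is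
      \<open>j\<close> because \<open>B\<close> has type \<open>p\<close>; outside \<open>P\<close>
      extensionality already fixes \<open>f\<close>.\<close>
    have "f \<in> extensional P" using F by (simp add: assembly_fibre_def PiE_def)
    then have "(restrict f (P - {B}))(B := j) = f"
      using B by (auto simp: fun_eq_iff extensional_def p_def)
    then show "h (g ((P, f), B)) = ((P, f), B)" using B by (auto simp: g_def h_def)
    have "B \<subseteq> A" using F B(1) by (auto simp: assembly_fibre_def partition_on_def)
    then show "g ((P, f), B) \<in> Z"
      using remove_block_in_fibre[OF F B] B(2) by (simp add: g_def Z_def b_def p_def)
  qed
  moreover have "g (h (B, P, f)) = (B, P, f)" "h (B, P, f) \<in> X" if "(B, P, f) \<in> Z" for P f B
  proof -
    have F: "(P, f) \<in> assembly_fibre m (A - B) (a(p := a p - 1))" and B: "B \<subseteq> A" "card B = i"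
      using that by (auto simp: Z_def b_def)
    have B': "B \<noteq> {}" "p = (card B, j)" "j \<in> {1..m (card B)}" "a p > 0"
      using B ij pos by (auto simp: p_def)
    note ins = insert_block_in_fibre[OF A F B(1) B']
    have "f \<in> extensional P" using F by (simp add: assembly_fibre_def PiE_def)
    then have "restrict (f(B := j)) (P - {B}) = f"
      using ins(2) by (auto simp: fun_eq_iff extensional_def restrict_def)
    then show "g (h (B, P, f)) = (B, P, f)" using ins(2) by (auto simp: g_def h_def)
    show "h (B, P, f) \<in> X" using ins(1) B'(2) by (simp add: h_def X_def)
  qed
  ultimately have "bij_betw g X Z"
    by (intro bij_betw_byWitness[where f' = h]) auto
  then have "card X = card Z" by (rule bij_betw_same_card)
  then show ?thesis using X Z by (simp add: p_def b_def)
qed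

text \<open>Induction on \<open>card A\<close>: for a type \<open>(i, j)\<close> that occurs, the
  double count turns the fibre on \<open>A\<close> into fibres on \<open>A - B\<close>, one for each
  \<open>i\<close>-subset \<open>B\<close>. By induction each term contributes
  \<open>fact (card A - i)\<close>, and there are \<open>card A choose i\<close> of them. The
  product form avoids division of natural numbers.\<close>

lemma card_assembly_fibre:
  assumes "finite A" "finite I" "I \<subseteq> objects m" "\<And>q. q \<notin> I \<Longrightarrow> a q = 0"
    "(\<Sum>q\<in>I. fst q * a q) = card A"
  shows "card (assembly_fibre m A a) * (\<Prod>q\<in>I. fact (fst q) ^ a q * fact (a q)) = (fact (card A) :: nat)"
  using assms
proof (induction "card A" arbitrary: A a rule: less_induct)
  case less
  show ?case
  proof (cases "\<exists>p\<in>I. a p > 0")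
    \<comment> \<open>With all counts zero the ground set is empty, the empty assembly is the only
      one, and both sides are 1.\<close>
    case False
    then have a: "a = (\<lambda>_. 0)" using less.prems(4) by (auto simp: fun_eq_iff)
    then have "A = {}" using less.prems by auto
    then have "assembly_fibre m A a = {({}, \<lambda>_. undefined)}"
      using a by (auto simp: assembly_fibre_def partition_on_empty)
    then show ?thesis using a \<open>A = {}\<close> by simp
  next
    case True
    then obtain i j where ij: "(i, j) \<in> I" "a (i, j) > 0" by auto
    define p where "p = (i, j)"
    define b where "b = a(p := a p - 1)"
    have p: "p \<in> I" "a p > 0" "fst p = i" "b p = a p - 1" using ij by (auto simp: p_def b_def)
    have obj: "1 \<le> i" "j \<in> {1..m i}" using ij less.prems(3) by (auto simp: objects_def)
    have sum_a: "(\<Sum>q\<in>I. fst q * a q) = i * a p + (\<Sum>q\<in>I - {p}. fst q * a q)"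
      using p less.prems(2) by (subst sum.remove[of I p]) auto
    have "(\<Sum>q\<in>I. fst q * b q) = i * (a p - 1) + (\<Sum>q\<in>I - {p}. fst q * b q)"
      using p less.prems(2) by (subst sum.remove[of I p]) auto
    also have "(\<Sum>q\<in>I - {p}. fst q * b q) = (\<Sum>q\<in>I - {p}. fst q * a q)"
      by (rule sum.cong) (auto simp: b_def)
    finally have sum_b': "(\<Sum>q\<in>I. fst q * b q) = i * (a p - 1) + (\<Sum>q\<in>I - {p}. fst q * a q)" .
    have "i * (a p - 1) + i = i * a p" using p(2) by (metis Suc_pred' mult_Suc_right add.commute)
    then have sum_b: "(\<Sum>q\<in>I. fst q * b q) + i = card A"
      using sum_a less.prems(5) sum_b' by linarith
    let ?w = "\<lambda>a. \<Prod>q\<in>I. fact (fst q) ^ a q * fact (a q) :: nat"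
    define R :: nat where "R = (\<Prod>q\<in>I - {p}. fact (fst q) ^ a q * fact (a q))"
    have "?w a = fact i ^ a p * fact (a p) * R"
      unfolding R_def p(3)[symmetric] by (rule prod.remove) (use p less.prems(2) in auto)
    moreover have "?w b = fact i ^ b p * fact (b p) * (\<Prod>q\<in>I - {p}. fact (fst q) ^ b q * fact (b q))"
      unfolding p(3)[symmetric] by (rule prod.remove) (use p less.prems(2) in auto)
    moreover have "(\<Prod>q\<in>I - {p}. fact (fst q) ^ b q * fact (b q)) = R"
      unfolding R_def by (rule prod.cong) (auto simp: b_def)
    moreover obtain k where "a p = Suc k" using p(2) gr0_implies_Suc by blast
    \<comment> \<open>Lowering \<open>a p\<close> by one removes one factor \<open>fact i\<close>
      and turns \<open>fact (a p)\<close> into \<open>fact (a p - 1)\<close>.\<close>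
    ultimately have w: "?w a = fact i * a p * ?w b"
      by (simp only: p(4)) (simp add: algebra_simps)
    have IH: "card (assembly_fibre m (A - B) b) * ?w b = fact (card A - i)"
      if "B \<subseteq> A" "card B = i" for B
    proof -
      have "card (A - B) = card A - i" using that less.prems(1) by (simp add: card_Diff_subset finite_subset)
      moreover have "b q = 0" if "q \<notin> I" for q
        using that less.prems(4) p(1) by (auto simp: b_def)
      moreover have "card A - i < card A" "(\<Sum>q\<in>I. fst q * b q) = card A - i"
        using sum_b obj(1) by linarith+
      ultimately show ?thesis
        using less.hyps[of "A - B" b] less.prems(1-3) by (metis finite_Diff)
    qed
    have "card (assembly_fibre m A a) * ?w a = fact i * (a p * card (assembly_fibre m A a)) * ?w b"
      by (simp add: w)
    also have "a p * card (assembly_fibre m A a)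
        = (\<Sum>B | B \<subseteq> A \<and> card B = i. card (assembly_fibre m (A - B) b))"
      unfolding p_def b_def by (rule card_assembly_fibre_step) (use less.prems obj ij in auto)
    also have "fact i * \<dots> * ?w b = fact i * (\<Sum>B | B \<subseteq> A \<and> card B = i. fact (card A - i))"
      by (simp add: sum_distrib_right IH mult.assoc)
    also have "\<dots> = fact i * fact (card A - i) * (card A choose i)"
      using n_subsets[OF less.prems(1)] by simp
    also have "\<dots> = fact (card A)"
      by (rule binomial_fact_lemma) (use sum_b in simp)
    finally show ?thesis .
  qed
qed

section \<open>Component counts of a structure of weight \<open>n\<close>\<close>

lemma finite_refined_index [simp]: "finite (refined_index m n)"
  by (simp add: refined_index_def)

lemma refined_index_subset_objects: "refined_index m n \<subseteq> objects m"
  by (auto simp: refined_index_def objects_def)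

lemma mem_refined_index_iff: "q \<in> refined_index m n \<longleftrightarrow> q \<in> objects m \<and> fst q \<le> n"
  by (cases q) (auto simp: refined_index_def objects_def)

lemma sum_mset_eq_sum_count:
  fixes f :: "'a \<Rightarrow> nat"
  assumes "finite S" "set_mset C \<subseteq> S"
  shows "(\<Sum>c\<in>#C. f c) = (\<Sum>q\<in>S. f q * count C q)"
  using assms(2)
proof (induction C)
  case (add c C)
  have "(\<Sum>q\<in>S. f q * count (add_mset c C) q)
      = (\<Sum>q\<in>S. (if q = c then f c else 0) + f q * count C q)"
    by (rule sum.cong) auto
  then show ?case using add assms(1) by (simp add: sum.distrib)
qed simp

text \<open>No component weighs more than the whole structure, and labels are bounded by
  \<open>m\<close> from the start. Hence the values on the finite index determine all
  counts.\<close>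

lemma component_count_outside:
  assumes "s \<in> structures K m n" "q \<notin> refined_index m n"
  shows "component_count q s = 0"
proof (cases K)
  case Assemblies
  then obtain P f where s: "s = Assembly P f" "partition_on {1..n} P" "f \<in> (\<Pi>\<^sub>E B\<in>P. {1..m (card B)})"
    using assms(1) by auto
  have "(card B, f B) \<in> refined_index m n" if "B \<in> P" for B
  proof -
    have "B \<subseteq> {1..n}" "B \<noteq> {}" using that s(2) by (auto simp: partition_on_def)
    then have "card B \<in> {1..n}"
      using card_mono[of "{1..n}" B] card_gt_0_iff[of B] finite_subset[of B "{1..n}"] by auto
    then show ?thesis using that s(3) by (auto simp: refined_index_def)
  qed
  then have "{B \<in> P. (card B, f B) = q} = {}" using assms(2) by blast
  then show ?thesis by (simp only: s(1) component_count_Assembly card.empty)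
next
  case Multisets
  then obtain C where s: "s = Multiset C" "set_mset C \<subseteq> objects m" "(\<Sum>c\<in>#C. fst c) = n"
    using assms(1) by auto
  have "fst c \<le> n" if "c \<in># C" for c
    using that s(3) by (auto dest!: multi_member_split)
  then have "q \<notin># C" using assms(2) s(2) unfolding mem_refined_index_iff by blast
  then show ?thesis using s(1) by (cases q) (simp add: not_in_iff)
next
  case Selections
  then obtain S where s: "s = Selection S" "finite S" "S \<subseteq> objects m" "(\<Sum>c\<in>S. fst c) = n"
    using assms(1) by auto
  have "fst c \<le> n" if "c \<in> S" for c
    using that s(2,4) member_le_sum[of c S fst] by auto
  then have "q \<notin> S" using assms(2) s(3) unfolding mem_refined_index_iff by blast
  then show ?thesis using s(1) by (cases q) simp
qed

text \<open>Grouping the components by type recovers the total weight. For assemblies this is the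
  sum of the block sizes, which is \<open>n\<close> because the blocks partition
  \<open>{1..n}\<close>.\<close>

lemma sum_component_count:
  assumes "s \<in> structures K m n"
  shows "(\<Sum>q\<in>refined_index m n. fst q * component_count q s) = n"
proof (cases K)
  case Assemblies
  then obtain P f where s: "s = Assembly P f" "partition_on {1..n} P"
    using assms by auto
  have fin: "finite P" using s(2) by (auto intro: finite_elements)
  have "(\<Sum>q\<in>refined_index m n. fst q * component_count q s)
      = (\<Sum>q\<in>refined_index m n. \<Sum>B\<in>{B \<in> P. (card B, f B) = q}. card B)"
    unfolding s(1) component_count_Assembly by (intro sum.cong refl) auto
  also have "\<dots> = (\<Sum>B\<in>P. card B)"
  proof (rule sum.group)
    show "(\<lambda>B. (card B, f B)) ` P \<subseteq> refined_index m n"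
    proof clarify
      fix B assume "B \<in> P"
      \<comment> \<open>\<open>B\<close> itself witnesses a positive count at its type, which is
        impossible outside the index.\<close>
      then have "B \<in> {C \<in> P. (card C, f C) = (card B, f B)}" by simp
      then have "component_count (card B, f B) s > 0"
        unfolding s(1) component_count_Assembly using fin by (auto simp: card_gt_0_iff)
      then show "(card B, f B) \<in> refined_index m n"
        using component_count_outside[OF assms] by fastforce
    qed
  qed (use fin in auto)
  also have "\<dots> = card (\<Union>P)"
  proof (rule card_Union_disjoint[symmetric])
    show "pairwise disjnt P" using s(2) by (simp add: partition_on_def disjoint_def pairwise_def disjnt_def)
    show "\<And>B. B \<in> P \<Longrightarrow> finite B"
      using s(2) by (metis partition_on_def Union_upper finite_atLeastAtMost finite_subset)
  qed
  finally show ?thesis using s(2) by (simp add: partition_on_def)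
next
  case Multisets
  then obtain C where s: "s = Multiset C" "(\<Sum>c\<in>#C. fst c) = n"
    using assms by auto
  have c: "component_count q s = count C q" for q using s(1) by (cases q) simp
  have "set_mset C \<subseteq> refined_index m n"
    using component_count_outside[OF assms] c by (metis not_in_iff subsetI)
  then show ?thesis
    using sum_mset_eq_sum_count[OF finite_refined_index, of C m n fst] s(2) by (simp add: c)
next
  case Selections
  then obtain S where s: "s = Selection S" "(\<Sum>c\<in>S. fst c) = n"
    using assms by auto
  have c: "component_count q s = of_bool (q \<in> S)" for q using s(1) by (cases q) simp
  have "S \<subseteq> refined_index m n"
    using component_count_outside[OF assms] c by fastforce
  then have "(\<Sum>q\<in>refined_index m n. fst q * component_count q s) = (\<Sum>q\<in>S. fst q)"
    by (intro sum.mono_neutral_cong_right) (auto simp: c)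
  then show ?thesis using s(2) by simp
qed

section \<open>Fibres of the component count map\<close>

definition structure_fibre ::
    "comb_type \<Rightarrow> (nat \<Rightarrow> nat) \<Rightarrow> nat \<Rightarrow> (nat \<times> nat \<Rightarrow> nat) \<Rightarrow> comb_structure set" where
  "structure_fibre K m n a = {s \<in> structures K m n. \<forall>q\<in>refined_index m n. component_count q s = a q}"

text \<open>\<open>structure_fibre\<close> constrains the counts on the index only,
  \<open>assembly_fibre\<close> everywhere. Extending \<open>a\<close> by 0 reconciles the two,
  since counts outside the index vanish.\<close>

lemma structure_fibre_Assemblies:
  "structure_fibre Assemblies m n a = (\<lambda>(P, f). Assembly P f) `
     assembly_fibre m {1..n} (\<lambda>q. if q \<in> refined_index m n then a q else 0)"
proof -
  have "Assembly P f \<in> structure_fibre Assemblies m n a \<longleftrightarrow>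
      (P, f) \<in> assembly_fibre m {1..n} (\<lambda>q. if q \<in> refined_index m n then a q else 0)" for P f
  proof -
    have "(\<forall>q\<in>refined_index m n. component_count q s = a q) \<longleftrightarrow>
        (\<forall>q. component_count q s = (if q \<in> refined_index m n then a q else 0))"
      if "s \<in> structures Assemblies m n" for s
      using component_count_outside[OF that] by auto
    then show ?thesis
      unfolding structure_fibre_def assembly_fibre_def component_count_Assembly[symmetric]
      by (auto simp del: component_count.simps)
  qed
  moreover have "\<exists>P f. s = Assembly P f" if "s \<in> structure_fibre Assemblies m n a" for s
    using that by (auto simp: structure_fibre_def)
  ultimately show ?thesis by (fastforce simp: image_iff)
qed

text \<open>A multiset is determined by its multiplicities, and the weight condition makes the one
  with multiplicities \<open>a\<close> admissible.\<close>

lemma structure_fibre_Multisets: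
  assumes "(\<Sum>q\<in>refined_index m n. fst q * a q) = n"
  shows "structure_fibre Multisets m n a = {Multiset (\<Sum>q\<in>refined_index m n. replicate_mset (a q) q)}"
proof -
  define D where "D = (\<Sum>q\<in>refined_index m n. replicate_mset (a q) q)"
  have count: "count D q = (if q \<in> refined_index m n then a q else 0)" for q
    by (simp add: D_def count_sum)
  have sub: "set_mset D \<subseteq> refined_index m n"
  proof
    fix q assume "q \<in># D"
    then have "count D q \<noteq> 0" by simp
    then show "q \<in> refined_index m n" using count[of q] by (simp split: if_splits)
  qed
  have "(\<Sum>c\<in>#D. fst c) = n"
    using assms by (simp add: sum_mset_eq_sum_count[OF finite_refined_index sub] count)
  then have "Multiset D \<in> structure_fibre Multisets m n a"
    using sub refined_index_subset_objects by (auto simp: structure_fibre_def count)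
  moreover have "s = Multiset D" if s: "s \<in> structure_fibre Multisets m n a" for s
  proof -
    have str: "s \<in> structures Multisets m n" using s by (simp add: structure_fibre_def)
    then obtain C where C: "s = Multiset C" by auto
    have "count C q = component_count q s" for q using C by (cases q) simp
    then have "count C q = count D q" for q
      using s component_count_outside[OF str] by (simp add: count structure_fibre_def)
    then show ?thesis using C by (simp add: multiset_eq_iff)
  qed
  ultimately show ?thesis unfolding D_def by blast
qed

text \<open>A selection is determined by its indicator function, so \<open>a\<close> is attained
  exactly when it takes only the values 0 and 1 on the index.\<close>

lemma structure_fibre_Selections:
  assumes "(\<Sum>q\<in>refined_index m n. fst q * a q) = n"
  shows "structure_fibre Selections m n a =
    (if \<forall>q\<in>refined_index m n. a q \<le> 1 then {Selection {q \<in> refined_index m n. a q = 1}} else {})"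
proof -
  have count: "component_count q (Selection S) = of_bool (q \<in> S)" for q S
    by (cases q) simp
  have *: "(\<forall>q\<in>refined_index m n. a q \<le> 1) \<and> s = Selection {q \<in> refined_index m n. a q = 1}"
    if s: "s \<in> structure_fibre Selections m n a" for s
  proof -
    have str: "s \<in> structures Selections m n" using s by (simp add: structure_fibre_def)
    then obtain S where S: "s = Selection S" by auto
    have a: "a q = of_bool (q \<in> S)" if "q \<in> refined_index m n" for q
      using s that by (auto simp: structure_fibre_def S count simp del: component_count.simps)
    have "q \<notin> S" if "q \<notin> refined_index m n" for q
      using component_count_outside[OF str that] by (simp add: S count)
    with a have "q \<in> S \<longleftrightarrow> q \<in> {q \<in> refined_index m n. a q = 1}" for q
      by (cases "q \<in> refined_index m n") simp_all
    then have "S = {q \<in> refined_index m n. a q = 1}" by blast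
    moreover have "\<forall>q\<in>refined_index m n. a q \<le> 1" using a by simp
    ultimately show ?thesis using S by simp
  qed
  moreover have "Selection {q \<in> refined_index m n. a q = 1} \<in> structure_fibre Selections m n a"
    if le: "\<forall>q\<in>refined_index m n. a q \<le> 1"
  proof -
    have a: "a q = of_bool (a q = 1)" if "q \<in> refined_index m n" for q
      using le that by (cases "a q") auto
    have "(\<Sum>q\<in>{q \<in> refined_index m n. a q = 1}. fst q) = (\<Sum>q\<in>refined_index m n. fst q * a q)"
    proof (rule sum.mono_neutral_cong_left)
      show "\<forall>q\<in>refined_index m n - {q \<in> refined_index m n. a q = 1}. fst q * a q = 0"
        using le by (auto simp: le_Suc_eq)
    qed auto
    then show ?thesis
      using assms refined_index_subset_objects[of m n] a
      by (auto simp: structure_fibre_def count simp del: component_count.simps)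
  qed
  ultimately show ?thesis by auto
qed

lemma structure_fibre_empty:
  assumes "(\<Sum>q\<in>refined_index m n. fst q * a q) \<noteq> n"
  shows "structure_fibre K m n a = {}"
proof -
  have "(\<Sum>q\<in>refined_index m n. fst q * a q) = n" if "s \<in> structure_fibre K m n a" for s
    using that sum_component_count[of s K m n] by (simp add: structure_fibre_def)
  then show ?thesis using assms by blast
qed

lemma finite_structure_fibre: "finite (structure_fibre K m n a)"
proof (cases "(\<Sum>q\<in>refined_index m n. fst q * a q) = n")
  case True
  then show ?thesis
    by (cases K) (simp_all add: structure_fibre_Assemblies structure_fibre_Multisets
        structure_fibre_Selections finite_assembly_fibre)
qed (simp add: structure_fibre_empty)

section \<open>Fibre sizes and point probabilities\<close>

lemma card_structure_fibre_Assemblies: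
  assumes "(\<Sum>q\<in>refined_index m n. fst q * a q) = n"
  shows "card (structure_fibre Assemblies m n a) * (\<Prod>q\<in>refined_index m n. fact (fst q) ^ a q * fact (a q))
    = (fact n :: nat)"
proof -
  define b where "b q = (if q \<in> refined_index m n then a q else 0)" for q
  have "card (structure_fibre Assemblies m n a) = card (assembly_fibre m {1..n} b)"
    unfolding structure_fibre_Assemblies b_def by (rule card_image) (auto simp: inj_on_def)
  moreover have "card (assembly_fibre m {1..n} b) * (\<Prod>q\<in>refined_index m n. fact (fst q) ^ b q * fact (b q))
      = (fact (card {1..n}) :: nat)"
    by (rule card_assembly_fibre) (use assms refined_index_subset_objects[of m n] in \<open>simp_all add: b_def\<close>)
  ultimately show ?thesis by (simp add: b_def)
qed

text \<open>The constant is \<open>C = n! x\<^sup>-\<^sup>n \<Prod> exp (x\<^sup>i / i!)\<close>, \<open>x\<^sup>-\<^sup>n \<Prod> 1 / (1 - x\<^sup>i)\<close> and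
  \<open>x\<^sup>-\<^sup>n \<Prod> (1 + x\<^sup>i)\<close> for the three types.\<close>

lemma card_structure_fibre_proportional:
  fixes x :: real
  assumes x: "x > 0" "K = Multisets \<Longrightarrow> x < 1"
  obtains C where "C > 0" "\<And>a. (\<Sum>q\<in>refined_index m n. fst q * a q) = n \<Longrightarrow>
    real (card (structure_fibre K m n a))
      = C * (\<Prod>q\<in>refined_index m n. pmf (component_pmf K x (fst q)) (a q))"
proof -
  let ?I = "refined_index m n"
  have xW: "(\<Prod>q\<in>?I. x ^ (fst q * a q)) = x ^ n" if "(\<Sum>q\<in>?I. fst q * a q) = n" for a
    using that by (simp flip: power_sum)
  have pos: "fst q \<ge> 1" if "q \<in> ?I" for q using that by (auto simp: refined_index_def)
  show thesis
  proof (cases K)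
    case Assemblies
    define E where "E = (\<Prod>q\<in>?I. exp (- (x ^ fst q / fact (fst q))))"
    have E: "E > 0" by (simp add: E_def prod_pos)
    have "real (card (structure_fibre K m n a))
        = (fact n / (x ^ n * E)) * (\<Prod>q\<in>?I. pmf (component_pmf K x (fst q)) (a q))"
      if a: "(\<Sum>q\<in>?I. fst q * a q) = n" for a
    proof -
      \<comment> \<open>\<open>w\<close> is the denominator both in the number of assemblies,
        \<open>fact n / w\<close>, and in the product of the Poisson masses.\<close>
      define w where "w = (\<Prod>q\<in>?I. fact (fst q) ^ a q * fact (a q) :: real)"
      have w: "w > 0" by (simp add: w_def prod_pos)
      have "real (card (structure_fibre K m n a)) * w = fact n"
        using arg_cong[OF card_structure_fibre_Assemblies[OF a], of real] Assemblies by (simp add: w_def)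
      then have "real (card (structure_fibre K m n a)) = fact n / w"
        using w by (simp add: field_simps)
      moreover have "(\<Prod>q\<in>?I. pmf (component_pmf K x (fst q)) (a q))
          = (\<Prod>q\<in>?I. x ^ (fst q * a q) / (fact (fst q) ^ a q * fact (a q)) * exp (- (x ^ fst q / fact (fst q))))"
        using x by (intro prod.cong refl)
          (simp add: Assemblies pmf_component_Assemblies power_divide power_mult del: component_pmf.simps)
      then have "(\<Prod>q\<in>?I. pmf (component_pmf K x (fst q)) (a q)) = x ^ n / w * E"
        unfolding prod.distrib prod_dividef E_def w_def xW[OF a] .
      ultimately show ?thesis using w E x(1) by simp
    qed
    moreover have "fact n / (x ^ n * E) > 0" using E x(1) by simp
    ultimately show thesis by (rule that[rotated])
  next
    case Multisets
    define E where "E = (\<Prod>q\<in>?I. 1 - x ^ fst q)"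
    \<comment> \<open>Weights are at least 1, so \<open>x < 1\<close> gives
      \<open>x ^ i < 1\<close>; for weight 0 the factor would vanish.\<close>
    have "1 - x ^ fst q > 0" if "q \<in> ?I" for q
      using pos[OF that] x Multisets by (simp add: power_less_one_iff)
    then have E: "E > 0" by (simp add: E_def prod_pos)
    have "real (card (structure_fibre K m n a))
        = (1 / (x ^ n * E)) * (\<Prod>q\<in>?I. pmf (component_pmf K x (fst q)) (a q))"
      if a: "(\<Sum>q\<in>?I. fst q * a q) = n" for a
    proof -
      have "(\<Prod>q\<in>?I. pmf (component_pmf K x (fst q)) (a q)) = (\<Prod>q\<in>?I. (1 - x ^ fst q) * x ^ (fst q * a q))"
        using x pos Multisets by (intro prod.cong refl)
          (simp add: pmf_component_Multisets del: component_pmf.simps)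
      also have "\<dots> = E * x ^ n" unfolding prod.distrib E_def xW[OF a] ..
      finally show ?thesis using E x(1) a by (simp add: Multisets structure_fibre_Multisets)
    qed
    moreover have "1 / (x ^ n * E) > 0" using E x(1) by simp
    ultimately show thesis by (rule that[rotated])
  next
    case Selections
    define E where "E = (\<Prod>q\<in>?I. 1 + x ^ fst q)"
    have E: "E > 0" using x by (simp add: E_def prod_pos add_pos_pos)
    have "real (card (structure_fibre K m n a))
        = (E / x ^ n) * (\<Prod>q\<in>?I. pmf (component_pmf K x (fst q)) (a q))"
      if a: "(\<Sum>q\<in>?I. fst q * a q) = n" for a
    proof (cases "\<forall>q\<in>?I. a q \<le> 1")
      case True
      have "pmf (component_pmf K x (fst q)) (a q) = x ^ (fst q * a q) / (1 + x ^ fst q)" if "q \<in> ?I" for q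
      proof -
        have "a q = 0 \<or> a q = 1" using True that by (auto simp: le_Suc_eq)
        then show ?thesis
          using pmf_component_Selections[OF x(1), of "fst q"]
          by (auto simp: Selections simp del: component_pmf.simps)
      qed
      then have "(\<Prod>q\<in>?I. pmf (component_pmf K x (fst q)) (a q)) = x ^ n / E"
        by (simp add: prod_dividef E_def xW[OF a])
      then show ?thesis using E x(1) a True by (simp add: Selections structure_fibre_Selections)
    next
      case False
      \<comment> \<open>Neither a selection nor a Bernoulli variable produces a count above 1, so
        both sides vanish.\<close>
      then obtain q where q: "q \<in> ?I" "a q > 1" by (auto simp: not_le)
      then have "a q \<notin> set_pmf (component_pmf K x (fst q))"
        by (auto simp: Selections of_bool_def split: if_splits)
      then have "(\<Prod>q\<in>?I. pmf (component_pmf K x (fst q)) (a q)) = 0"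
        using q(1) by (auto simp: set_pmf_iff)
      moreover have "structure_fibre K m n a = {}"
        using False by (simp only: Selections structure_fibre_Selections[OF a] if_False)
      ultimately show ?thesis by (simp only: card.empty mult_zero_right of_nat_0)
    qed
    moreover have "E / x ^ n > 0" using E x(1) by simp
    ultimately show thesis by (rule that[rotated])
  qed
qed

section \<open>Conditioning on the total weight\<close>

theorem theorem4:
  fixes K :: comb_type and m :: "nat \<Rightarrow> nat" and n :: nat and x :: real
    and M :: "'a measure" and Y :: "nat \<times> nat \<Rightarrow> 'a \<Rightarrow> nat" and T :: "'a \<Rightarrow> nat"
  assumes "n \<ge> 1"
    and "x > 0"
    and "K = Multisets \<Longrightarrow> x < 1"
    and "prob_space M"
    and "prob_space.indep_vars M (\<lambda>_. count_space UNIV) Y (refined_index m n)"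
    and "\<And>i j. (i, j) \<in> refined_index m n \<Longrightarrow>
           distr M (count_space UNIV) (Y (i, j)) = measure_pmf (component_pmf K x i)"
    and "\<And>\<omega>. T \<omega> = (\<Sum>i=1..n. \<Sum>j=1..m i. i * Y (i, j) \<omega>)"
    and "measure M {\<omega> \<in> space M. T \<omega> = n} > 0"
  shows "distr (measure_pmf (pmf_of_set (structures K m n)))
             (\<Pi>\<^sub>M p\<in>refined_index m n. count_space UNIV)
             (\<lambda>s. \<lambda>p\<in>refined_index m n. component_count p s)
       = distr (uniform_measure M {\<omega> \<in> space M. T \<omega> = n})
             (\<Pi>\<^sub>M p\<in>refined_index m n. count_space UNIV)
             (\<lambda>\<omega>. \<lambda>p\<in>refined_index m n. Y p \<omega>)"
proof -
  interpret prob_space M by (rule assms(4))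
  define I where "I = refined_index m n"
  define S where "S = structures K m n"
  define E where "E = {\<omega> \<in> space M. T \<omega> = n}"
  define W where "W a = (\<Sum>q\<in>I. fst q * a q)" for a :: "nat \<times> nat \<Rightarrow> nat"
  define R where "R = {a \<in> I \<rightarrow>\<^sub>E UNIV. W a = n}"
  define A where "A a = {\<omega> \<in> space M. \<forall>q\<in>I. Y q \<omega> = a q}" for a
  define D where "D s = (\<lambda>q\<in>I. component_count q s)" for s
  define V where "V \<omega> = (\<lambda>q\<in>I. Y q \<omega>)" for \<omega>
  have fin_I: "finite I" by (simp add: I_def)
  have T: "T \<omega> = W (\<lambda>q. Y q \<omega>)" for \<omega>
    unfolding assms(7) W_def I_def refined_index_def by (simp add: sum.Sigma split_beta)
  \<comment> \<open>An empty index would force \<open>T = 0\<close>, but \<open>n \<ge> 1\<close>.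
    The product formula for independent events below is applied to a nonempty index set.\<close>
  have "I \<noteq> {}"
  proof
    assume "I = {}"
    then have "T \<omega> \<noteq> n" for \<omega> using assms(1) by (simp add: T W_def)
    then show False using assms(8) by simp
  qed
  have Y: "Y q \<in> measurable M (count_space UNIV)" if "q \<in> I" for q
    using assms(5) that by (simp add: indep_vars_def I_def)
  \<comment> \<open>Over a finite index the product sigma-algebra is discrete, so both laws can be
    compared on singletons.\<close>
  have PiM: "(\<Pi>\<^sub>M q\<in>I. count_space (UNIV :: nat set)) = count_space (I \<rightarrow>\<^sub>E UNIV)"
    by (rule count_space_PiM_finite[OF fin_I]) simp
  have V: "V \<in> measurable M (\<Pi>\<^sub>M q\<in>I. count_space UNIV)"
    unfolding V_def by (rule measurable_restrict) (rule Y)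
  have A_vimage: "A a = V -` {a} \<inter> space M" if "a \<in> I \<rightarrow>\<^sub>E UNIV" for a
    using that by (auto simp: A_def V_def fun_eq_iff PiE_iff extensional_def)
  have A_event: "A a \<in> events" if "a \<in> I \<rightarrow>\<^sub>E UNIV" for a
    unfolding A_vimage[OF that] by (rule measurable_sets[OF V]) (use that in \<open>simp add: PiM\<close>)
  have prob_A: "prob (A a) = (\<Prod>q\<in>I. pmf (component_pmf K x (fst q)) (a q))" for a
  proof -
    have "prob (A a) = prob (\<Inter>q\<in>I. Y q -` {a q} \<inter> space M)"
      using \<open>I \<noteq> {}\<close> by (intro arg_cong[where f = prob]) (auto simp: A_def)
    also have "\<dots> = (\<Prod>q\<in>I. prob (Y q -` {a q} \<inter> space M))"
      by (rule indep_varsD_finite[OF assms(5)[folded I_def] \<open>I \<noteq> {}\<close> fin_I]) simp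
    also have "\<dots> = (\<Prod>q\<in>I. pmf (component_pmf K x (fst q)) (a q))"
    proof (rule prod.cong[OF refl])
      fix q assume q: "q \<in> I"
      have "prob (Y q -` {a q} \<inter> space M) = measure (distr M (count_space UNIV) (Y q)) {a q}"
        by (rule measure_distr[symmetric]) (use Y[OF q] in auto)
      also have "distr M (count_space UNIV) (Y q) = measure_pmf (component_pmf K x (fst q))"
        using assms(6)[of "fst q" "snd q"] q by (simp add: I_def)
      finally show "prob (Y q -` {a q} \<inter> space M) = pmf (component_pmf K x (fst q)) (a q)"
        by (simp add: measure_pmf_single)
    qed
    finally show ?thesis .
  qed
  obtain C where C: "C > 0" "\<And>a. W a = n \<Longrightarrow> real (card (structure_fibre K m n a)) = C * prob (A a)"
    unfolding prob_A W_def I_def by (rule card_structure_fibre_proportional[OF assms(2,3)]) blast+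
  \<comment> \<open>All weights are at least 1, so no single count can exceed the total
    \<open>n\<close>; this makes \<open>R\<close> finite.\<close>
  have "R \<subseteq> I \<rightarrow>\<^sub>E {..n}"
  proof
    fix a assume a: "a \<in> R"
    have "a q \<le> n" if "q \<in> I" for q
    proof -
      have "a q \<le> fst q * a q" using that by (auto simp: I_def refined_index_def)
      also have "\<dots> \<le> W a" unfolding W_def by (rule member_le_sum) (use that fin_I in auto)
      finally show ?thesis using a by (simp add: R_def)
    qed
    then show "a \<in> I \<rightarrow>\<^sub>E {..n}" using a by (auto simp: R_def PiE_iff)
  qed
  then have fin_R: "finite R" by (rule finite_subset) (simp add: finite_PiE fin_I)
  \<comment> \<open>The conditioning event splits into the finitely many disjoint events that fix
    the whole vector \<open>V\<close>.\<close>
  have E: "E = (\<Union>a\<in>R. A a)"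
  proof -
    have "\<omega> \<in> E \<longleftrightarrow> \<omega> \<in> space M \<and> V \<omega> \<in> R" for \<omega>
      by (simp add: E_def R_def T W_def V_def)
    moreover have "\<omega> \<in> (\<Union>a\<in>R. A a) \<longleftrightarrow> \<omega> \<in> space M \<and> V \<omega> \<in> R" for \<omega>
      using A_vimage by (auto simp: R_def)
    ultimately show ?thesis by blast
  qed
  have A_disjoint: "disjoint_family_on A R"
    unfolding disjoint_family_on_def using A_vimage by (auto simp: R_def)
  have E_event: "E \<in> events"
    unfolding E using fin_R A_event by (auto simp: R_def)
  have prob_E: "prob E = (\<Sum>a\<in>R. prob (A a))"
    unfolding E using A_event by (intro finite_measure_finite_Union fin_R A_disjoint) (auto simp: R_def)
  have fibre: "structure_fibre K m n a = S \<inter> D -` {a}" if "a \<in> I \<rightarrow>\<^sub>E UNIV" for a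
    using that unfolding structure_fibre_def S_def D_def I_def
    by (auto simp: fun_eq_iff PiE_iff extensional_def)
  have D_R: "D s \<in> R" if "s \<in> S" for s
    using sum_component_count[of s K m n] that by (simp add: D_def R_def W_def S_def I_def)
  have S: "S = (\<Union>a\<in>R. structure_fibre K m n a)"
    using fibre D_R by (auto simp: R_def)
  have fin_S: "finite S" unfolding S using fin_R finite_structure_fibre by blast
  have "card S = (\<Sum>a\<in>R. card (structure_fibre K m n a))"
    unfolding S
  proof (rule card_UN_disjoint[OF fin_R])
    show "\<forall>a\<in>R. finite (structure_fibre K m n a)" by (simp add: finite_structure_fibre)
    show "\<forall>a\<in>R. \<forall>b\<in>R. a \<noteq> b \<longrightarrow> structure_fibre K m n a \<inter> structure_fibre K m n b = {}"
      using fibre by (auto simp: R_def)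
  qed
  \<comment> \<open>Summing the proportionality over \<open>R\<close> relates the two normalising
    constants.\<close>
  then have card_S: "real (card S) = C * prob E"
    using C(2) by (simp add: prob_E sum_distrib_left R_def)
  have "prob E > 0" using assms(8) by (simp add: E_def)
  \<comment> \<open>Positivity of the conditioning event thus guarantees that a structure exists, so
    that the uniform law on \<open>S\<close> is meaningful.\<close>
  then have "S \<noteq> {}" using card_S C(1) by auto
  have "distr (measure_pmf (pmf_of_set S)) (\<Pi>\<^sub>M q\<in>I. count_space UNIV) D
      = distr (uniform_measure M E) (\<Pi>\<^sub>M q\<in>I. count_space UNIV) V"
  proof (rule measure_eqI_countable)
    show "countable (I \<rightarrow>\<^sub>E (UNIV :: nat set))" by (rule countable_PiE[OF fin_I]) simp
    fix a :: "nat \<times> nat \<Rightarrow> nat" assume a: "a \<in> I \<rightarrow>\<^sub>E UNIV"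
    \<comment> \<open>Intersecting with \<open>E\<close> extends the proportionality to vectors of
      the wrong weight, where both sides are 0.\<close>
    have card_a: "real (card (structure_fibre K m n a)) = C * prob (E \<inter> A a)"
    proof (cases "W a = n")
      case True
      then have "E \<inter> A a = A a" using a by (auto simp: E R_def)
      then show ?thesis using C(2)[OF True] by simp
    next
      case False
      then have "E \<inter> A a = {}" using A_vimage[OF a] A_vimage by (auto simp: E R_def)
      then show ?thesis using False structure_fibre_empty[of a m n K] by (simp add: W_def I_def)
    qed
    have "emeasure (distr (measure_pmf (pmf_of_set S)) (\<Pi>\<^sub>M q\<in>I. count_space UNIV) D) {a}
        = emeasure (measure_pmf (pmf_of_set S)) (D -` {a})"
      using a by (subst emeasure_distr) (auto simp: PiM D_def)
    \<comment> \<open>The mass is the fibre size divided by \<open>card S\<close>; the common factor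
      \<open>C\<close> cancels.\<close>
    also have "\<dots> = ennreal (prob (E \<inter> A a) / prob E)"
      using C(1) by (simp add: emeasure_pmf_of_set[OF \<open>S \<noteq> {}\<close> fin_S] flip: fibre[OF a])
        (simp add: card_a card_S)
    also have "\<dots> = emeasure (uniform_measure M E) (A a)"
      using \<open>prob E > 0\<close> E_event A_event[OF a]
      by (simp add: emeasure_uniform_measure emeasure_eq_measure divide_ennreal)
    also have "\<dots> = emeasure (distr (uniform_measure M E) (\<Pi>\<^sub>M q\<in>I. count_space UNIV) V) {a}"
      using a V by (subst emeasure_distr) (auto simp: PiM A_vimage)
    finally show "emeasure (distr (measure_pmf (pmf_of_set S)) (\<Pi>\<^sub>M q\<in>I. count_space UNIV) D) {a}
        = emeasure (distr (uniform_measure M E) (\<Pi>\<^sub>M q\<in>I. count_space UNIV) V) {a}" .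
  qed (simp_all add: PiM)
  then show ?thesis unfolding D_def[abs_def] V_def[abs_def] S_def I_def E_def .
qed

end
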